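(* Let $\mathbf{s}=(s_1,\dots,s_n)$ be a sequence of positive integers and let $\mathbf{s}^*=(s_1,\dots,s_n,1)$. Then the $\delta$-vector of the $\mathbf{s}$-lecture hall polytope $P_{\mathbf{s}}$ is given by \[\delta_{P_{\mathbf{s}},i}=\#\{\mathbf{r}\in \Psi_n\times\langle 0\rangle \;:\; \operatorname{des}_{\mathbf{s}^*}(\mathbf{r})=i\},\qquad 0\le i\le n.\] Furthermore, if $s_n=1$, then \[\delta_{P_{\mathbf{s}},i}=\#\{\mathbf{r}\in\Psi_n \;:\; \operatorname{des}_{\mathbf{s}}(\mathbf{r})=i\},\qquad 0\le i\le n.\]
   Context: For a nonnegative integer $N$, $\langle N\rangle=\{0,1,\dots,N\}$, and $\Psi_n=\langle s_1-1\rangle\times\cdots\times\langle s_n-1\rangle$. The $\mathbf{s}$-lecture hall polytope $P_{\mathbf{s}}\subset\mathbb{R}^n$ is defined by $0\le x_1/s_1\le x_2/s_2\le\cdots\le x_n/s_n\le 1$; it is an integral $n$-dimensional polytope. For an integral $n$-dimensional polytope $P$, with $i(P,t)=\#(tP\cap\mathbb{Z}^n)$, one has $\sum_{t\ge0}i(P,t)z^t=\delta_P(z)/(1-z)^{n+1}$ with $\delta_P(z)=\sum_{i=0}^n\delta_{P,i}z^i$ a polynomial; $(\delta_{P,0},\dots,\delta_{P,n})$ is the $\delta$-vector. For a sequence $\mathbf{t}=(t_1,\dots,t_m)$ of positive integers and $\mathbf{r}=(r_1,\dots,r_m)\in\mathbb{N}^m$, an index $i\in\{1,\dots,m-1\}$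 is a $\mathbf{t}$-descent of $\mathbf{r}$ if $r_i/t_i>r_{i+1}/t_{i+1}$, and $\operatorname{des}_{\mathbf{t}}(\mathbf{r})$ is the number of $\mathbf{t}$-descents of $\mathbf{r}$. *)

theory Defs
  imports Complex_Main "HOL-Computational_Algebra.Computational_Algebra"
begin

text \<open>
  Points of \<open>\<real>\<^sup>n\<close>, and integer sequences, are lists of length \<open>n\<close>; the entry with
  mathematical index \<open>i\<close> is at list position \<open>i - 1\<close>.
\<close>

definition lattice_points :: "nat \<Rightarrow> real list set" where
  "lattice_points n = {x. length x = n \<and> set x \<subseteq> \<int>}"

definition dilate :: "nat \<Rightarrow> real list set \<Rightarrow> real list set" where
  "dilate t P = (\<lambda>x. map (\<lambda>a. real t * a) x) ` P"

definition ehrhart :: "nat \<Rightarrow> real list set \<Rightarrow> nat \<Rightarrow> nat" where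
  "ehrhart n P t = card (dilate t P \<inter> lattice_points n)"

definition ehrhart_series :: "nat \<Rightarrow> real list set \<Rightarrow> rat fps" where
  "ehrhart_series n P = Abs_fps (\<lambda>t. of_nat (ehrhart n P t))"

text \<open>
  Here \<open>n\<close> is both the dimension of the ambient space and that of \<open>P\<close>. At most one polynomial
  satisfies the condition; one exists when \<open>P\<close> is an integral \<open>n\<close>-dimensional polytope.
\<close>

definition delta_poly :: "nat \<Rightarrow> real list set \<Rightarrow> rat poly" where
  "delta_poly n P = (THE p. degree p \<le> n \<and>
     ehrhart_series n P = fps_of_poly p / (1 - fps_X) ^ (n + 1))"

definition delta :: "nat \<Rightarrow> real list set \<Rightarrow> nat \<Rightarrow> rat" where
  "delta n P i = coeff (delta_poly n P) i"

text \<open>The chain \<open>0 \<le> x\<^sub>1/s\<^sub>1 \<le> \<dots> \<le> x\<^sub>n/s\<^sub>n \<le> 1\<close> is sortedness of the list of its terms.\<close>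

definition lecture_hall_polytope :: "nat list \<Rightarrow> real list set" where
  "lecture_hall_polytope s =
     {x. length x = length s \<and> sorted (0 # map2 (\<lambda>a k. a / real k) x s @ [1])}"

definition Psi :: "nat list \<Rightarrow> nat list set" where
  "Psi s = {r. length r = length s \<and> (\<forall>j<length s. r ! j \<in> {0..s ! j - 1})}"

definition des :: "nat list \<Rightarrow> nat list \<Rightarrow> nat" where
  "des t r = card {j. Suc j < length t \<and>
     real (r ! j) / real (t ! j) > real (r ! Suc j) / real (t ! Suc j)}"

end

theory Submission
  imports Defs
begin

text \<open>
  Write a lattice point of \<open>t P\<close> as \<open>x\<^sub>j = q\<^sub>j s\<^sub>j + r\<^sub>j\<close> with \<open>0 \<le> r\<^sub>j < s\<^sub>j\<close>. Then
  \<open>x\<^sub>j/s\<^sub>j \<le> x\<^sub>j\<^sub>+\<^sub>1/s\<^sub>j\<^sub>+\<^sub>1\<close> says that \<open>q\<^sub>j + e\<^sub>j \<le> q\<^sub>j\<^sub>+\<^sub>1\<close>, where \<open>e\<^sub>j\<close> is 1 if \<open>j\<close> is a descent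
  of \<open>r\<close> and 0 otherwise; the bound \<open>x\<^sub>n/s\<^sub>n \<le> t\<close> fits the same pattern with \<open>q\<^sub>n\<^sub>+\<^sub>1 = t\<close>,
  \<open>r\<^sub>n\<^sub>+\<^sub>1 = 0\<close>, \<open>s\<^sub>n\<^sub>+\<^sub>1 = 1\<close>. Hence each \<open>r\<close> contributes \<open>z\<^sup>d / (1 - z)\<^sup>n\<^sup>+\<^sup>1\<close> to the Ehrhart
  series, where \<open>d\<close> is its number of descents. For an induction on \<open>s\<close> from the right, the bound
  \<open>t\<close> is generalized to \<open>t + u/k\<close> with \<open>u < k\<close>.
\<close>

section \<open>Lattice points of a chain with a real upper bound\<close>

definition lh_points :: "nat list \<Rightarrow> real \<Rightarrow> nat list set" where
  "lh_points s b =
     {x. length x = length s \<and> sorted (map2 (\<lambda>a k. real a / real k) x s @ [b])}"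

lemma lh_points_Nil [simp]: "lh_points [] b = {[]}"
  by (auto simp: lh_points_def)

lemma snoc_in_lh_points_iff:
  assumes "length x = length s"
  shows "x @ [a] \<in> lh_points (s @ [m]) b \<longleftrightarrow> x \<in> lh_points s (a / m) \<and> a / m \<le> b"
  using assms by (fastforce simp: lh_points_def sorted_append intro: order_trans)

text \<open>Once the last entry \<open>a\<close> is chosen, its quotient \<open>a / m\<close> bounds
  the remaining chain. Such quotients are the reason for allowing an arbitrary real bound
  \<open>b\<close>.\<close>

lemma lh_points_snoc:
  "lh_points (s @ [m]) b =
     (\<lambda>(a, x). x @ [a]) ` (SIGMA a:{a. real a / real m \<le> b}. lh_points s (a / m))"
proof (intro set_eqI iffI)
  fix y assume y: "y \<in> lh_points (s @ [m]) b"
  then obtain x a where xa: "y = x @ [a]" "length x = length s"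
    by (auto simp: lh_points_def length_Suc_conv_rev)
  show "y \<in> (\<lambda>(a, x). x @ [a]) ` (SIGMA a:{a. real a / real m \<le> b}. lh_points s (a / m))"
    using y xa snoc_in_lh_points_iff[OF xa(2)] by force
next
  fix y assume "y \<in> (\<lambda>(a, x). x @ [a]) ` (SIGMA a:{a. real a / real m \<le> b}. lh_points s (a / m))"
  then obtain x a where "y = x @ [a]" "x \<in> lh_points s (a / m)" "a / m \<le> b"
    by auto
  moreover from this have "length x = length s"
    by (simp add: lh_points_def)
  ultimately show "y \<in> lh_points (s @ [m]) b"
    using snoc_in_lh_points_iff by blast
qed

lemma finite_quotients_le:
  assumes "0 < m"
  shows "finite {a::nat. real a / real m \<le> b}"
proof (rule finite_subset)
  show "{a::nat. real a / real m \<le> b} \<subseteq> {..nat \<lfloor>b * m\<rfloor>}"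
    using assms by (auto simp: field_simps le_nat_floor)
qed simp

lemma finite_lh_points:
  assumes "\<forall>k\<in>set s. 0 < k"
  shows "finite (lh_points s b)"
  using assms
  by (induction s arbitrary: b rule: rev_induct)
     (auto simp: lh_points_snoc intro!: finite_SigmaI finite_quotients_le)

lemma card_lh_points_snoc:
  assumes "\<forall>k\<in>set (s @ [m]). 0 < k"
  shows "card (lh_points (s @ [m]) b) =
    (\<Sum>a | real a / real m \<le> b. card (lh_points s (a / m)))"
proof -
  have "inj_on (\<lambda>(a, x). x @ [a]) A" for A :: "(nat \<times> nat list) set"
    by (auto simp: inj_on_def)
  then have "card (lh_points (s @ [m]) b) =
      card (SIGMA a:{a. real a / real m \<le> b}. lh_points s (a / m))"
    unfolding lh_points_snoc by (rule card_image)
  then show ?thesis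
    using assms by (simp add: finite_quotients_le finite_lh_points)
qed

section \<open>Division with remainder and partial sums\<close>

text \<open>Both \<open>v / m\<close> and \<open>u / k\<close> lie in [0, 1), so the integer parts
  \<open>q\<close> and \<open>t\<close> decide the comparison; only a tie depends on the fractions,
  and it fails exactly when \<open>v / m > u / k\<close>.\<close>

lemma quotient_le_iff:
  fixes u k v m q t :: nat
  assumes "u < k" "v < m"
  shows "real (q * m + v) / m \<le> t + u / k \<longleftrightarrow> q + of_bool (v / m > u / k) \<le> t"
proof -
  have split: "real (q * m + v) / m = q + v / m"
    using assms by (simp add: field_simps)
  have frac: "0 \<le> u / k" "real u / k < 1" "0 \<le> v / m" "real v / m < 1"
    using assms by simp_all
  show ?thesis
  proof (cases "v / m > u / k")
    case True
    then have "real q + v / m \<le> t + u / k \<longleftrightarrow> q < t"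
      using frac by (intro iffI; linarith)
    then show ?thesis
      unfolding split using True by (simp add: Suc_le_eq)
  next
    case False
    then have "real q + v / m \<le> t + u / k \<longleftrightarrow> q \<le> t"
      using frac by (intro iffI; linarith)
    then show ?thesis
      unfolding split using False by simp
  qed
qed

lemma sum_quotients_le:
  fixes f :: "nat \<Rightarrow> 'a::comm_monoid_add" and u k m t :: nat
  assumes "u < k" "0 < m"
  shows "(\<Sum>a | real a / m \<le> t + u / k. f a) =
    (\<Sum>v<m. \<Sum>q | q + of_bool (real v / m > u / k) \<le> t. f (q * m + v))"
proof -
  have fin: "finite {q. q + (c::nat) \<le> t}" for c
    by (rule finite_subset[of _ "{..t}"]) auto
  have "(\<Sum>v<m. \<Sum>q | q + of_bool (real v / m > u / k) \<le> t. f (q * m + v)) =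
    (\<Sum>(v, q) \<in> (SIGMA v:{..<m}. {q. q + of_bool (real v / m > u / k) \<le> t}). f (q * m + v))"
    by (intro sum.Sigma ballI fin finite_lessThan)
  also have "\<dots> = (\<Sum>a | real a / m \<le> t + u / k. f a)"
  proof (rule sum.reindex_bij_witness[where i = "\<lambda>a. (a mod m, a div m)"
        and j = "\<lambda>(v, q). q * m + v"])
    fix a :: nat assume "a \<in> {a. real a / m \<le> t + u / k}"
    then show "(a mod m, a div m) \<in>
        (SIGMA v:{..<m}. {q. q + of_bool (real v / m > u / k) \<le> t})"
      using quotient_le_iff[OF assms(1), of "a mod m" m "a div m" t] assms by simp
  qed (use assms quotient_le_iff[OF assms(1)] in auto)
  finally show ?thesis ..
qed

text \<open>Multiplying by \<open>1 - fps_X\<close> takes differences of consecutive coefficients,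
  which undoes summation. If \<open>P\<close> holds, the sums run over \<open>q < t\<close> only,
  and this delay is the factor \<open>fps_X\<close>.\<close>

lemma fps_partial_sums:
  fixes c :: "nat \<Rightarrow> 'a::comm_ring_1"
  shows "Abs_fps (\<lambda>t. \<Sum>q | q + of_bool P \<le> t. c q) * (1 - fps_X) =
    fps_X ^ of_bool P * Abs_fps c"
proof (rule fps_ext)
  fix t
  have less: "{q. Suc q \<le> t} = {..<t}" and le: "{q. q \<le> t} = {..t}" for t
    by auto
  show "(Abs_fps (\<lambda>t. \<Sum>q | q + of_bool P \<le> t. c q) * (1 - fps_X)) $ t =
      (fps_X ^ of_bool P * Abs_fps c) $ t"
    by (cases t; cases P) (auto simp: less le algebra_simps simp flip: lessThan_Suc_atMost)
qed

section \<open>Remainder vectors, their descents and the generating function\<close>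

lemma Psi_Nil [simp]: "Psi [] = {[]}"
  by (auto simp: Psi_def)

text \<open>Positivity of \<open>m\<close> matters: by truncated subtraction
  \<open>{0..m - 1}\<close> is \<open>{0}\<close> for \<open>m = 0\<close>, while
  \<open>{..<m}\<close> is empty.\<close>

lemma Psi_snoc:
  assumes "0 < m"
  shows "Psi (s @ [m]) = (\<lambda>(v, r). r @ [v]) ` ({..<m} \<times> Psi s)"
proof (intro set_eqI iffI)
  fix y assume y: "y \<in> Psi (s @ [m])"
  then obtain r v where rv: "y = r @ [v]" "length r = length s"
    by (auto simp: Psi_def length_Suc_conv_rev)
  have "y ! j \<le> (s @ [m]) ! j - 1" if "j < Suc (length s)" for j
    using y that by (auto simp: Psi_def)
  from this[of "length s"] have "v \<le> m - 1"
    by (simp add: rv nth_append)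
  moreover have "r \<in> Psi s"
    using y rv by (force simp: Psi_def nth_append split: if_splits)
  ultimately show "y \<in> (\<lambda>(v, r). r @ [v]) ` ({..<m} \<times> Psi s)"
    using rv(1) assms by force
next
  fix y assume "y \<in> (\<lambda>(v, r). r @ [v]) ` ({..<m} \<times> Psi s)"
  then show "y \<in> Psi (s @ [m])"
    by (auto simp: Psi_def nth_append less_Suc_eq)
qed

lemma finite_Psi: "\<forall>k\<in>set s. 0 < k \<Longrightarrow> finite (Psi s)"
  by (induction s rule: rev_induct) (auto simp: Psi_snoc)

lemma length_Psi: "r \<in> Psi s \<Longrightarrow> length r = length s"
  by (simp add: Psi_def)

lemma des_singleton [simp]: "des [k] r = 0"
  by (simp add: des_def)

text \<open>The only new pair of neighbours sits at index \<open>length s\<close>, where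
  \<open>v / m\<close> meets \<open>u / k\<close>.\<close>

lemma des_snoc:
  assumes "length r = length s"
  shows "des (s @ [m, k]) (r @ [v, u]) =
    des (s @ [m]) (r @ [v]) + of_bool (real v / m > real u / k)"
proof -
  define D where "D = {j. Suc j < length (s @ [m]) \<and>
     real ((r @ [v]) ! j) / real ((s @ [m]) ! j) >
     real ((r @ [v]) ! Suc j) / real ((s @ [m]) ! Suc j)}"
  have fin: "finite D" and notin: "length s \<notin> D"
    by (auto simp: D_def)
  have D: "des (s @ [m]) (r @ [v]) = card D"
    unfolding des_def D_def ..
  have "{j. Suc j < length (s @ [m, k]) \<and>
     real ((r @ [v, u]) ! j) / real ((s @ [m, k]) ! j) >
     real ((r @ [v, u]) ! Suc j) / real ((s @ [m, k]) ! Suc j)} =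
     D \<union> (if real v / m > real u / k then {length s} else {})"
    using assms by (auto simp: D_def nth_append nth_Cons' less_Suc_eq)
  then have "des (s @ [m, k]) (r @ [v, u]) =
      card (D \<union> (if real v / m > real u / k then {length s} else {}))"
    unfolding des_def by (rule arg_cong)
  then show ?thesis
    unfolding D using fin notin by simp
qed

lemma des_le: "des (s @ [k]) r \<le> length s"
proof -
  have "des (s @ [k]) r \<le> card {..<length s}"
    unfolding des_def by (rule card_mono) auto
  then show ?thesis by simp
qed

text \<open>The free pair \<open>u\<close>, \<open>k\<close> makes the induction work: the remainder
  and modulus split off on the right become the pair for the shorter sequence.\<close>

lemma lh_points_series:
  assumes "\<forall>k\<in>set s. 0 < k" "u < k"
  shows "Abs_fps (\<lambda>t. of_nat (card (lh_points s (t + u / k))) :: 'a::comm_ring_1) *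
      (1 - fps_X) ^ (length s + 1) =
    (\<Sum>r\<in>Psi s. fps_X ^ des (s @ [k]) (r @ [u]))"
  using assms
proof (induction s arbitrary: u k rule: rev_induct)
  case Nil
  \<comment> \<open>The empty chain has one point for every \<open>t\<close>, which leaves the
    geometric series.\<close>
  have "Abs_fps (\<lambda>t. 1) * (1 - fps_X) = (1 :: 'a fps)"
    by (rule fps_ext) (simp add: algebra_simps)
  then show ?case by simp
next
  case (snoc m s)
  let ?e = "\<lambda>v. of_bool (real v / m > real u / k) :: nat"
  let ?c = "\<lambda>v q. of_nat (card (lh_points s (q + v / m))) :: 'a"
  have m: "0 < m" and s: "\<forall>k\<in>set s. 0 < k"
    using snoc.prems by auto
  have "Abs_fps (\<lambda>t. of_nat (card (lh_points (s @ [m]) (t + u / k))) :: 'a) =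
      Abs_fps (\<lambda>t. \<Sum>v<m. \<Sum>q | q + ?e v \<le> t. ?c v q)"
    using snoc.prems m
    by (simp add: card_lh_points_snoc sum_quotients_le add_divide_distrib)
  also have "\<dots> = (\<Sum>v<m. Abs_fps (\<lambda>t. \<Sum>q | q + ?e v \<le> t. ?c v q))"
    by (rule fps_ext) (simp add: fps_sum_nth)
  finally have "Abs_fps (\<lambda>t. of_nat (card (lh_points (s @ [m]) (t + u / k))) :: 'a) *
      (1 - fps_X) ^ (length (s @ [m]) + 1) =
      (\<Sum>v<m. Abs_fps (\<lambda>t. \<Sum>q | q + ?e v \<le> t. ?c v q) * (1 - fps_X) *
        (1 - fps_X) ^ (length s + 1))"
    by (simp add: sum_distrib_right mult.assoc)
  \<comment> \<open>One factor \<open>1 - fps_X\<close> is spent on the sum over \<open>q\<close>;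
    the others are left for the induction hypothesis.\<close>
  also have "\<dots> = (\<Sum>v<m. fps_X ^ ?e v * (Abs_fps (?c v) * (1 - fps_X) ^ (length s + 1)))"
    by (simp only: fps_partial_sums mult.assoc)
  \<comment> \<open>The induction hypothesis is used with \<open>v\<close> and \<open>m\<close> in
    place of \<open>u\<close> and \<open>k\<close>.\<close>
  also have "\<dots> = (\<Sum>v<m. fps_X ^ ?e v * (\<Sum>r\<in>Psi s. fps_X ^ des (s @ [m]) (r @ [v])))"
    by (intro sum.cong refl arg_cong2[of _ _ _ _ "(*)"] snoc.IH s) simp
  also have "\<dots> = (\<Sum>v<m. \<Sum>r\<in>Psi s. fps_X ^ des (s @ [m, k]) (r @ [v, u]))"
    by (intro sum.cong refl) (simp add: sum_distrib_left des_snoc length_Psi power_add mult.commute)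
  also have "\<dots> = (\<Sum>r\<in>Psi (s @ [m]). fps_X ^ des ((s @ [m]) @ [k]) (r @ [u]))"
    unfolding Psi_snoc[OF m] sum.cartesian_product
    by (subst sum.reindex) (auto simp: inj_on_def intro!: sum.cong)
  finally show ?case .
qed

section \<open>Dilates of the polytope and their lattice points\<close>

lemma dilate_lecture_hall_polytope:
  assumes "\<forall>k\<in>set s. 0 < k"
  shows "dilate t (lecture_hall_polytope s) =
     {x. length x = length s \<and> sorted (0 # map2 (\<lambda>a k. a / real k) x s @ [real t])}"
    (is "_ = ?R")
proof (intro set_eqI iffI)
  fix y assume "y \<in> dilate t (lecture_hall_polytope s)"
  then obtain x where x: "y = map (\<lambda>a. real t * a) x" "length x = length s"
      "sorted (0 # map2 (\<lambda>a k. a / real k) x s @ [1])"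
    by (auto simp: dilate_def lecture_hall_polytope_def)
  have "sorted (map (\<lambda>a. real t * a) (0 # map2 (\<lambda>a k. a / real k) x s @ [1]))"
    by (rule sorted_map_mono[OF x(3)]) (auto intro!: monoI mono_onI mult_left_mono)
  then show "y \<in> ?R"
    using x by (simp add: zip_map1 comp_def case_prod_unfold)
next
  fix y assume y: "y \<in> ?R"
  \<comment> \<open>For \<open>t = 0\<close>, division by zero makes this the zero vector, which
    still lies in the polytope.\<close>
  define x where "x = map (\<lambda>a. a / real t) y"
  have x_eq: "map2 (\<lambda>a k. a / real k) x s =
      map (\<lambda>a. a / real t) (map2 (\<lambda>a k. a / real k) y s)"
    by (simp add: x_def zip_map1 comp_def case_prod_unfold mult.commute)
  have "sorted (map (\<lambda>a. a / real t) (0 # map2 (\<lambda>a k. a / real k) y s @ [real t]))"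
    using y by (intro sorted_map_mono) (auto intro!: mono_onI divide_right_mono)
  then have "sorted (0 # map2 (\<lambda>a k. a / real k) x s @ [1])"
    unfolding x_eq by (cases "t = 0") (auto simp: sorted_append)
  then have "x \<in> lecture_hall_polytope s"
    using y by (simp add: lecture_hall_polytope_def x_def)
  moreover have "map (\<lambda>a. real t * a) x = y"
  proof (cases "t = 0")
    case True
    \<comment> \<open>With \<open>t = 0\<close> both ends of the chain are 0, so every quotient, and
      hence every entry of \<open>y\<close>, vanishes.\<close>
    have bounds: "0 \<le> a / real k" "a / real k \<le> 0" if "(a, k) \<in> set (zip y s)" for a k
      using y True that by (auto simp: sorted_append)
    have "y ! j = 0" if "j < length y" for j
    proof -
      have "(y ! j, s ! j) \<in> set (zip y s)"
        using y that by (force simp: set_zip)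
      then have "y ! j / real (s ! j) = 0"
        using bounds by (meson order_antisym)
      moreover have "0 < s ! j"
        using y that assms by auto
      ultimately show ?thesis by simp
    qed
    then show ?thesis
      using True by (auto simp: x_def intro!: nth_equalityI)
  qed (simp add: x_def comp_def)
  ultimately show "y \<in> dilate t (lecture_hall_polytope s)"
    unfolding dilate_def by (rule image_eqI[OF sym, rotated])
qed

text \<open>The lower bound 0 of the chain makes all integer entries natural numbers, so
  \<open>map real\<close> matches the two sets of points.\<close>

lemma ehrhart_lecture_hall_polytope:
  assumes "\<forall>k\<in>set s. 0 < k"
  shows "ehrhart (length s) (lecture_hall_polytope s) t = card (lh_points s t)"
proof -
  have "dilate t (lecture_hall_polytope s) \<inter> lattice_points (length s) =
      map real ` lh_points s t"
    unfolding dilate_lecture_hall_polytope[OF assms]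
  proof (intro set_eqI iffI)
    fix y
    assume y: "y \<in> {x. length x = length s \<and>
        sorted (0 # map2 (\<lambda>a k. a / real k) x s @ [real t])} \<inter> lattice_points (length s)"
    have "a \<in> \<nat>" if a: "a \<in> set y" for a
    proof -
      obtain j where j: "j < length y" "a = y ! j"
        using a by (auto simp: in_set_conv_nth)
      have "a / real (s ! j) \<in> set (map2 (\<lambda>a k. a / real k) y s)"
        using y j by (force simp: set_zip)
      then have "0 \<le> a / real (s ! j)"
        using y by auto
      moreover have "0 < s ! j"
        using y j assms by auto
      ultimately have "0 \<le> a"
        by (simp add: zero_le_divide_iff)
      moreover have "a \<in> \<int>"
        using y a by (auto simp: lattice_points_def)
      ultimately show ?thesis
        by (simp add: Nats_altdef2)
    qed
    then have "y \<in> lists (range real)"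
      by (auto simp: Nats_def)
    then obtain x where "y = map real x"
      by (auto simp: lists_image)
    then show "y \<in> map real ` lh_points s t"
      using y by (auto simp: lh_points_def zip_map1 comp_def case_prod_unfold)
  next
    fix y assume "y \<in> map real ` lh_points s t"
    then show "y \<in> {x. length x = length s \<and>
        sorted (0 # map2 (\<lambda>a k. a / real k) x s @ [real t])} \<inter> lattice_points (length s)"
      by (auto simp: lh_points_def lattice_points_def zip_map1 comp_def case_prod_unfold)
  qed
  moreover have "inj_on (map real) A" for A
    by (auto simp: inj_on_def)
  ultimately show ?thesis
    by (simp add: ehrhart_def card_image)
qed

section \<open>The delta-vector\<close>

text \<open>The power of \<open>1 - fps_X\<close> is a unit, so the quotient equation defining
  \<open>delta_poly\<close> is a product equation; injectivity of \<open>fps_of_poly\<close> then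
  gives uniqueness.\<close>

lemma delta_poly_eqI:
  assumes "degree p \<le> n"
    and "ehrhart_series n P * (1 - fps_X) ^ (n + 1) = fps_of_poly p"
  shows "delta_poly n P = p"
proof -
  have unit: "is_unit ((1 - fps_X :: rat fps) ^ (n + 1))"
    by (simp add: is_unit_power_iff)
  have iff: "ehrhart_series n P = fps_of_poly q / (1 - fps_X) ^ (n + 1) \<longleftrightarrow>
      ehrhart_series n P * (1 - fps_X) ^ (n + 1) = fps_of_poly q" for q
    using unit_eq_div2[OF unit] .
  show ?thesis
    unfolding delta_poly_def iff using assms by (intro the_equality) auto
qed

lemma delta_lecture_hall_polytope:
  assumes "\<forall>k\<in>set s. 0 < k"
  shows "delta (length s) (lecture_hall_polytope s) i =
    of_nat (card {r \<in> Psi s. des (s @ [1]) (r @ [0]) = i})"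
proof -
  define p :: "rat poly" where "p = (\<Sum>r\<in>Psi s. monom 1 (des (s @ [1]) (r @ [0])))"
  have "degree p \<le> length s"
    unfolding p_def
    by (intro degree_sum_le finite_Psi assms order.trans[OF degree_monom_le] des_le)
  moreover have "ehrhart_series (length s) (lecture_hall_polytope s) *
      (1 - fps_X) ^ (length s + 1) = fps_of_poly p"
    \<comment> \<open>The choice \<open>u = 0\<close>, \<open>k = 1\<close> gives the bound
      \<open>t\<close> itself and appends the entry 0 with modulus 1.\<close>
    using lh_points_series[OF assms, of 0 1, where 'a = rat]
    by (simp add: ehrhart_series_def ehrhart_lecture_hall_polytope assms p_def fps_of_poly_sum
        fps_of_poly_monom)
  ultimately have "delta_poly (length s) (lecture_hall_polytope s) = p"
    by (rule delta_poly_eqI)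
  then show ?thesis
    using sum.inter_filter[OF finite_Psi[OF assms], of "\<lambda>_. 1 :: rat"]
    by (simp add: delta_def p_def coeff_sum)
qed

theorem theorem3p9:
  fixes s :: "nat list" and n :: nat
  assumes "length s = n"
    and "\<forall>k\<in>set s. 0 < k"
  shows "(\<forall>i\<le>n. delta n (lecture_hall_polytope s) i =
            of_nat (card {q \<in> {r @ [0] | r. r \<in> Psi s}. des (s @ [1]) q = i})) \<and>
         (n \<ge> 1 \<and> s ! (n - 1) = 1 \<longrightarrow>
           (\<forall>i\<le>n. delta n (lecture_hall_polytope s) i =
              of_nat (card {r \<in> Psi s. des s r = i})))"
proof -
  have delta: "delta n (lecture_hall_polytope s) i =
      of_nat (card {r \<in> Psi s. des (s @ [1]) (r @ [0]) = i})" for i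
    using delta_lecture_hall_polytope[OF assms(2)] assms(1) by simp
  have card: "card {q \<in> {r @ [0] | r. r \<in> Psi s}. des (s @ [1]) q = i} =
      card {r \<in> Psi s. des (s @ [1]) (r @ [0]) = i}" for i
  proof -
    have "{q \<in> {r @ [0] | r. r \<in> Psi s}. des (s @ [1]) q = i} =
        (\<lambda>r. r @ [0]) ` {r \<in> Psi s. des (s @ [1]) (r @ [0]) = i}"
      by auto
    then show ?thesis
      by (simp add: card_image inj_on_def)
  qed
  \<comment> \<open>A last modulus 1 forces the last remainder to be 0, so the appended pair
    compares 0 with 0 and adds no descent.\<close>
  have des: "des (s @ [1]) (r @ [0]) = des s r"
    if last: "n \<ge> 1" "s ! (n - 1) = 1" and r: "r \<in> Psi s" for r
  proof -
    obtain s' where s': "s = s' @ [1]"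
      using last assms(1) by (cases s rule: rev_cases) auto
    then obtain r' where "r = r' @ [0]" "r' \<in> Psi s'"
      using r by (auto simp: Psi_snoc)
    then show ?thesis
      using des_snoc[of r' s' 1 1 0 0] s' by (simp add: length_Psi)
  qed
  have "{r \<in> Psi s. des (s @ [1]) (r @ [0]) = i} = {r \<in> Psi s. des s r = i}"
    if "n \<ge> 1" "s ! (n - 1) = 1" for i
    using des[OF that] by auto
  then show ?thesis
    unfolding delta card by simp
qed

end
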